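(* Let $P_{(d_w,d_z)}$ be a restrictive polynomial correspondence of bidegree $(d_w,d_z)$, and let $\rho$ be a positive integer. Then $\mathrm{Rank}\left(M_{P_{(d_w,d_z)}}\right)=\rho$ if and only if all the three following statements hold (for some polynomials $g_1,\dots,g_\rho$ and $h_1,\dots,h_\rho$): 1. $P_{(d_w,d_z)}(z,w)$ can be rewritten as $g_1(w)h_1(z)+\cdots+g_\rho(w)h_\rho(z)$, where $$g_r(w)=\sum_{n=0}^{d_z}\alpha_{(n,r)}w^n\quad\text{and}\quad h_r(z)=\sum_{m=0}^{d_w}\beta_{(m,r)}z^m$$ (with complex coefficients), with $\alpha_{(d_z,r)}\neq0$ for some $1\le r\le\rho$ and $\beta_{(d_w,r)}\neq0$ for some $1\le r\le\rho$. 2. The collection of vectors $\left\{\left(\beta_{(m,r)}\right)_{0\le m\le d_w}\right\}_{1\le r\le\rho}$ is linearly independent. 3. The collection of vectors $\left\{\left(\alpha_{(n,r)}\right)_{0\le n\le d_z}\right\}_{1\le r\le\rho}$ is linearly independent.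
   Context: Let $d_w,d_z$ be strictly positive integers. A polynomial correspondence of bidegree $(d_w,d_z)$ is a polynomial $P(z,w)=\sum_{j=0}^{d_w}\sum_{k=0}^{d_z}\Lambda_{(j,k)}z^jw^k\in\mathbb{C}[z,w]$ of degree $d_w$ in $z$ and degree $d_z$ in $w$, such that (P1) no linear polynomial in $z$ divides $P$, and (P2) no linear polynomial in $w$ divides $P$. Standing assumption: at least one of $d_w,d_z$ is strictly bigger than $1$. Its associated matrix $M_P$ is the $(d_w+1)\times(d_z+1)$ matrix of coefficients whose rows are indexed by $j=d_w,d_w-1,\dots,0$ and columns by $k=d_z,d_z-1,\dots,0$, with entry $\Lambda_{(j,k)}$ in position $(j,k)$. Solutions are taken in $\mathbb{P}^1=\mathbb{C}\cup\{\infty\}$, using the biprojective completion of the zero set of $P$ in $\mathbb{P}^1\times\mathbb{P}^1$, and are counted with multiplicity. For a point $z_0$, $L_w(z_0)=[w^{(1)}(z_0),\dots,w^{(d_z)}(z_0)]$ is the list (multiset) of the $d_z$ solutions $w$ of $P(z_0,w)=0$; for a point $w_0$, $L_z(w_0)$ is the list (multiset) of the $d_w$ solutions $z$ of $P(z,w_0)=0$. $P$ is called restrictive if for every $z_0\in\mathbb{C}$ the lists $L_z(w^{(1)}(z_0)),\dots,L_z(w^{(d_z)}(z_0))$ all coincide. *)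

theory Defs
  imports
    "HOL-Computational_Algebra.Computational_Algebra"
    "Jordan_Normal_Form.DL_Rank"
begin

text \<open>
  A polynomial \<open>P(z, w)\<close> over the complex numbers is an element of \<open>complex poly poly\<close>, read as a
  polynomial in \<open>z\<close> (outer variable) with coefficients in \<open>C[w]\<close> (inner variable). Following the
  source, \<open>dw\<close> is the degree in \<open>z\<close>, i.e. the number of solutions \<open>z\<close> for given \<open>w\<close>, and \<open>dz\<close> is the
  degree in \<open>w\<close>.
\<close>

definition Lam :: "complex poly poly \<Rightarrow> nat \<Rightarrow> nat \<Rightarrow> complex" where
  "Lam P j k = Polynomial.coeff (Polynomial.coeff P j) k"

definition deg_z :: "complex poly poly \<Rightarrow> nat" where
  "deg_z P = Polynomial.degree P"

definition deg_w :: "complex poly poly \<Rightarrow> nat" where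
  "deg_w P = (MAX j\<in>{..Polynomial.degree P}. Polynomial.degree (Polynomial.coeff P j))"

definition in_z :: "complex poly \<Rightarrow> complex poly poly" where
  "in_z q = map_poly (\<lambda>c. [:c:]) q"

definition in_w :: "complex poly \<Rightarrow> complex poly poly" where
  "in_w q = [:q:]"

definition poly_correspondence :: "nat \<Rightarrow> nat \<Rightarrow> complex poly poly \<Rightarrow> bool" where
  "poly_correspondence dw dz P \<longleftrightarrow>
     0 < dw \<and> 0 < dz \<and> deg_z P = dw \<and> deg_w P = dz \<and>
     (\<forall>q. Polynomial.degree q = 1 \<longrightarrow> \<not> in_z q dvd P) \<and>
     (\<forall>q. Polynomial.degree q = 1 \<longrightarrow> \<not> in_w q dvd P)"

definition assoc_mat :: "nat \<Rightarrow> nat \<Rightarrow> complex poly poly \<Rightarrow> complex mat" where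
  "assoc_mat dw dz P = mat (dw + 1) (dz + 1) (\<lambda>(r, c). Lam P (dw - r) (dz - c))"

datatype proj_line = Finite complex | Infty

fun hom_coords :: "proj_line \<Rightarrow> complex \<times> complex" where
  "hom_coords (Finite a) = (a, 1)"
| "hom_coords Infty = (1, 0)"

text \<open>
  The biprojective completion of the zero set of \<open>P\<close> is the zero set of the bihomogeneous form
  \<open>\<Sum>j k. \<Lambda>(j,k) z^j z'^(dw-j) w^k w'^(dz-k)\<close>. Fixing one point of the projective line leaves
  a binary form in the other pair of variables; \<open>fibre_w\<close> and \<open>fibre_z\<close> are its dehomogenisations
  at \<open>w' = 1\<close> and \<open>z' = 1\<close>.
\<close>

definition fibre_w :: "nat \<Rightarrow> nat \<Rightarrow> complex poly poly \<Rightarrow> proj_line \<Rightarrow> complex poly" where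
  "fibre_w dw dz P x = (case hom_coords x of (a, b) \<Rightarrow>
     \<Sum>k\<le>dz. Polynomial.monom (\<Sum>j\<le>dw. Lam P j k * a ^ j * b ^ (dw - j)) k)"

definition fibre_z :: "nat \<Rightarrow> nat \<Rightarrow> complex poly poly \<Rightarrow> proj_line \<Rightarrow> complex poly" where
  "fibre_z dw dz P y = (case hom_coords y of (a, b) \<Rightarrow>
     \<Sum>j\<le>dw. Polynomial.monom (\<Sum>k\<le>dz. Lam P j k * a ^ k * b ^ (dz - k)) j)"

text \<open>
  The zeros, with multiplicity, of the binary form of degree \<open>d\<close> whose dehomogenisation is \<open>p\<close>: the
  multiplicity of the point at infinity is the drop in degree. Only meaningful for \<open>p \<noteq> 0\<close>; for the
  fibres of a polynomial correspondence this is ensured by the bidegree and the two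
  non-divisibility conditions.
\<close>

definition form_zeros :: "nat \<Rightarrow> complex poly \<Rightarrow> proj_line multiset" where
  "form_zeros d p =
     image_mset Finite (proots p) + replicate_mset (d - Polynomial.degree p) Infty"

definition L_w :: "nat \<Rightarrow> nat \<Rightarrow> complex poly poly \<Rightarrow> proj_line \<Rightarrow> proj_line multiset" where
  "L_w dw dz P z = form_zeros dz (fibre_w dw dz P z)"

definition L_z :: "nat \<Rightarrow> nat \<Rightarrow> complex poly poly \<Rightarrow> proj_line \<Rightarrow> proj_line multiset" where
  "L_z dw dz P w = form_zeros dw (fibre_z dw dz P w)"

definition restrictive :: "nat \<Rightarrow> nat \<Rightarrow> complex poly poly \<Rightarrow> bool" where
  "restrictive dw dz P \<longleftrightarrow>
     (\<forall>z0 :: complex. \<forall>w1 \<in># L_w dw dz P (Finite z0). \<forall>w2 \<in># L_w dw dz P (Finite z0).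
        L_z dw dz P w1 = L_z dw dz P w2)"

text \<open>
  Linear independence of an indexed family: \<open>inj_on\<close> is needed because \<open>lin_dep\<close> is
  a predicate on sets of vectors and would not see repetitions.
\<close>

definition lin_indpt_family :: "nat \<Rightarrow> 'i set \<Rightarrow> ('i \<Rightarrow> complex vec) \<Rightarrow> bool" where
  "lin_indpt_family n I v \<longleftrightarrow>
     inj_on v I \<and> v ` I \<subseteq> carrier_vec n \<and>
     \<not> LinearCombinations.module.lin_dep class_ring (module_vec TYPE(complex) n) (v ` I)"

end

theory Submission
  imports Defs
begin

text \<open>
  The associated matrix is the coefficient array of \<open>P\<close>, so writing \<open>P\<close> as
  \<open>\<Sum>r. g\<^sub>r(w) h\<^sub>r(z)\<close> amounts to writing that array as a sum of \<open>\<rho>\<close> outer products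
  \<open>\<beta>\<^sub>r \<alpha>\<^sub>r\<^sup>T\<close> of coefficient vectors. The theorem is thus the rank factorisation theorem
  (\<open>rank_eq_iff_outer_product_sum\<close>): a matrix has rank \<open>\<rho>\<close> iff it is a sum of \<open>\<rho>\<close> outer products
  whose left factors and whose right factors are both linearly independent.

  Given the rank, the left factors are a basis of the column space chosen among the columns, and
  the right factors are the coordinates of the columns in it; the basis columns themselves have
  unit coordinate vectors, which makes the right factors independent. Conversely, independent right
  factors possess a dual family (\<open>independent_on_imp_dual_family\<close>); applying its members to the
  matrix recovers each left factor as a combination of columns. The left factors therefore form a
  basis of the column space, and its dimension is \<open>\<rho>\<close>.

  The two conditions on leading coefficients come from the bidegree: if all \<open>\<beta>\<^bsub>(dw,r)\<^esub>\<close> vanished, so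
  would the coefficient of \<open>z^dw\<close> in \<open>P\<close>, contrary to the degree of \<open>P\<close> in \<open>z\<close>; the same holds
  for \<open>w\<close>.
\<close>

section \<open>Independent families in coordinates\<close>

text \<open>
  The family is given by its coordinates, \<open>b n r\<close> being coordinate \<open>n\<close> of member \<open>r\<close>. Coefficients
  are attached to indices rather than to vectors, so a repeated vector counts as dependent.
\<close>

definition independent_on :: "'n set \<Rightarrow> 'i set \<Rightarrow> ('n \<Rightarrow> 'i \<Rightarrow> 'a::field) \<Rightarrow> bool" where
  "independent_on N I b \<longleftrightarrow>
     (\<forall>c. (\<forall>n\<in>N. (\<Sum>r\<in>I. c r * b n r) = 0) \<longrightarrow> (\<forall>r\<in>I. c r = 0))"

lemma independent_onD:
  assumes "independent_on N I b" "\<And>n. n \<in> N \<Longrightarrow> (\<Sum>r\<in>I. c r * b n r) = 0" "r \<in> I"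
  shows "c r = 0"
  using assms unfolding independent_on_def by blast

lemma independent_on_cong:
  assumes "\<And>n r. n \<in> N \<Longrightarrow> r \<in> I \<Longrightarrow> b n r = b' n r"
  shows "independent_on N I b \<longleftrightarrow> independent_on N I b'"
  unfolding independent_on_def using assms by simp

lemma independent_on_image:
  "independent_on (f ` N) I b \<longleftrightarrow> independent_on N I (\<lambda>n. b (f n))"
  unfolding independent_on_def by simp

lemma independent_on_rev:
  "independent_on {..<Suc d} I (\<lambda>n. b (d - n)) \<longleftrightarrow> independent_on {..<Suc d} I b"
proof -
  have "bij_betw (\<lambda>n. d - n) {..<Suc d} {..<Suc d}"
    by (rule bij_betwI[where g = "\<lambda>n. d - n"]) auto
  then have "(\<lambda>n. d - n) ` {..<Suc d} = {..<Suc d}"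
    by (rule bij_betw_imp_surj_on)
  then show ?thesis
    using independent_on_image[of "\<lambda>n. d - n" "{..<Suc d}" I b] by simp
qed

lemma independent_on_subset:
  assumes "independent_on N J b" "I \<subseteq> J" "finite J"
  shows "independent_on N I b"
  unfolding independent_on_def
proof (intro allI impI ballI)
  fix c r
  assume c: "\<forall>n\<in>N. (\<Sum>r\<in>I. c r * b n r) = 0" and r: "r \<in> I"
  define c' where "c' s = (if s \<in> I then c s else 0)" for s
  have "(\<Sum>s\<in>J. c' s * b n s) = (\<Sum>s\<in>I. c s * b n s)" for n
    using assms(2,3) by (intro sum.mono_neutral_cong_right) (auto simp: c'_def)
  then have "c' r = 0"
    using independent_onD[OF assms(1), of c' r] c r assms(2) by auto
  then show "c r = 0"
    using r by (simp add: c'_def)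
qed

text \<open>
  The dual family is built one member at a time. When a vector \<open>x\<close> is added, its residual after
  subtracting its expansion by the dual family constructed so far is nonzero at some coordinate
  \<open>m\<close>. The functional \<open>e\<close> reads off coordinate \<open>m\<close> of the residual, scaled to take the value 1 at
  \<open>x\<close>; multiples of \<open>e\<close> then correct the earlier functionals so that they vanish at \<open>x\<close>.
\<close>

lemma independent_on_imp_dual_family:
  fixes b :: "'n \<Rightarrow> 'i \<Rightarrow> 'a::field"
  assumes "finite I" "finite N" "independent_on N I b"
  shows "\<exists>d. \<forall>r\<in>I. \<forall>s\<in>I. (\<Sum>n\<in>N. d r n * b n s) = (if r = s then 1 else 0)"
  using assms(1,3)
proof (induction I rule: finite_induct)
  case empty
  show ?case by simp
next
  case (insert x I)
  have "independent_on N I b"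
    using independent_on_subset[OF insert.prems] insert.hyps by auto
  then obtain d where d: "(\<Sum>n\<in>N. d r n * b n s) = (if r = s then 1 else 0)"
    if "r \<in> I" "s \<in> I" for r s
    using insert.IH by blast
  define D where "D r v = (\<Sum>n\<in>N. d r n * v n)" for r and v :: "'n \<Rightarrow> 'a"
  have D: "D r (\<lambda>n. b n s) = (if r = s then 1 else 0)" if "r \<in> I" "s \<in> I" for r s
    unfolding D_def using d that .
  define res where "res v m = v m - (\<Sum>r\<in>I. D r v * b m r)" for v m
  \<comment> \<open>A vanishing residual would be a dependence in which \<open>x\<close> has coefficient 1.\<close>
  have "\<exists>m\<in>N. res (\<lambda>n. b n x) m \<noteq> 0"
  proof (rule ccontr)
    assume "\<not> ?thesis"
    then have res0: "res (\<lambda>n. b n x) m = 0" if "m \<in> N" for m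
      using that by blast
    define c where "c r = (if r = x then 1 else - D r (\<lambda>n. b n x))" for r
    have "(\<Sum>r\<in>I. c r * b n r) = - (\<Sum>r\<in>I. D r (\<lambda>n. b n x) * b n r)" for n
      unfolding sum_negf[symmetric] using insert.hyps(2)
      by (intro sum.cong) (auto simp: c_def)
    then have "(\<Sum>r\<in>insert x I. c r * b n r) = res (\<lambda>n. b n x) n" for n
      using insert.hyps by (simp add: res_def c_def)
    then have "c x = 0"
      using independent_onD[OF insert.prems, of c x] res0 by simp
    then show False
      by (simp add: c_def)
  qed
  then obtain m where m: "m \<in> N" "res (\<lambda>n. b n x) m \<noteq> 0" by blast
  define \<kappa> where "\<kappa> = res (\<lambda>n. b n x) m"
  define e where "e n = ((if n = m then 1 else 0) - (\<Sum>r\<in>I. d r n * b m r)) / \<kappa>" for n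
  have e: "(\<Sum>n\<in>N. e n * v n) = res v m / \<kappa>" for v
  proof -
    have "e n * v n = ((if n = m then v n else 0) - (\<Sum>r\<in>I. d r n * v n * b m r)) / \<kappa>" for n
    proof -
      have "(\<Sum>r\<in>I. d r n * v n * b m r) = (\<Sum>r\<in>I. d r n * b m r) * v n"
        by (simp add: sum_distrib_left mult_ac)
      then show ?thesis
        by (simp add: e_def left_diff_distrib)
    qed
    then have "(\<Sum>n\<in>N. e n * v n)
        = (\<Sum>n\<in>N. (if n = m then v n else 0) - (\<Sum>r\<in>I. d r n * v n * b m r)) / \<kappa>"
      by (simp only: sum_divide_distrib)
    also have "\<dots> = (v m - (\<Sum>r\<in>I. \<Sum>n\<in>N. d r n * v n * b m r)) / \<kappa>"
      using m(1) assms(2) by (simp add: sum_subtractf sum.swap[of _ N I])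
    also have "\<dots> = res v m / \<kappa>"
      by (simp add: res_def D_def sum_distrib_right)
    finally show ?thesis .
  qed
  have res_old: "res (\<lambda>n. b n s) m = 0" if "s \<in> I" for s
  proof -
    have "(\<Sum>r\<in>I. D r (\<lambda>n. b n s) * b m r) = (\<Sum>r\<in>I. if r = s then b m r else 0)"
      using D that by (intro sum.cong) auto
    then show ?thesis
      using that insert.hyps(1) by (simp add: res_def)
  qed
  define d' where
    "d' r n = (if r = x then e n else d r n - D r (\<lambda>n. b n x) * e n)" for r n
  have d': "(\<Sum>n\<in>N. d' r n * v n)
      = (if r = x then res v m / \<kappa> else D r v - D r (\<lambda>n. b n x) * (res v m / \<kappa>))" for r v
  proof (cases "r = x")
    case True
    then show ?thesis by (simp add: d'_def e)
  next
    case False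
    have "(d r n - D r (\<lambda>n. b n x) * e n) * v n
        = d r n * v n - D r (\<lambda>n. b n x) * (e n * v n)" for n
      by (simp add: algebra_simps)
    then have "(\<Sum>n\<in>N. d' r n * v n) = D r v - D r (\<lambda>n. b n x) * (\<Sum>n\<in>N. e n * v n)"
      using False by (simp add: d'_def D_def sum_subtractf sum_distrib_left)
    then show ?thesis
      using False by (simp add: e)
  qed
  have "(\<Sum>n\<in>N. d' r n * b n s) = (if r = s then 1 else 0)"
    if "r \<in> insert x I" "s \<in> insert x I" for r s
    using that m(2) insert.hyps(2) by (auto simp: d' res_old D \<kappa>_def[symmetric])
  then show ?case by blast
qed

section \<open>Rank factorisation\<close>

context vec_space
begin

lemma inj_on_and_lin_indpt_iff:
  assumes fin: "finite I" and v: "v ` I \<subseteq> carrier_vec n"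
  shows "inj_on v I \<and> lin_indpt (v ` I) \<longleftrightarrow> independent_on {..<n} I (\<lambda>i r. v r $ i)"
proof
  assume asm: "inj_on v I \<and> lin_indpt (v ` I)"
  show "independent_on {..<n} I (\<lambda>i r. v r $ i)"
    unfolding independent_on_def
  proof (intro allI impI ballI)
    fix c r
    assume c: "\<forall>i\<in>{..<n}. (\<Sum>r\<in>I. c r * v r $ i) = 0" and r: "r \<in> I"
    define a where "a = c \<circ> inv_into I v"
    have a: "a (v s) = c s" if "s \<in> I" for s
      using that asm by (simp add: a_def)
    have "lincomb a (v ` I) = 0\<^sub>v n"
    proof (rule eq_vecI)
      show "dim_vec (lincomb a (v ` I)) = dim_vec (0\<^sub>v n :: 'a vec)"
        using lincomb_dim[of "v ` I" a] fin v by simp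
      fix i assume "i < dim_vec (0\<^sub>v n :: 'a vec)"
      then have i: "i < n" by simp
      have "lincomb a (v ` I) $ i = (\<Sum>s\<in>I. a (v s) * v s $ i)"
        using asm by (simp add: lincomb_index[OF i v] sum.reindex)
      also have "\<dots> = (\<Sum>s\<in>I. c s * v s $ i)"
        using a by (intro sum.cong) auto
      finally show "lincomb a (v ` I) $ i = 0\<^sub>v n $ i"
        using c i by simp
    qed
    then have "a \<in> v ` I \<rightarrow> {0}"
      using not_lindepD[of "v ` I" "v ` I" a] asm fin by simp
    then show "c r = 0"
      using a[OF r] r by (simp add: Pi_iff)
  qed
next
  assume indep: "independent_on {..<n} I (\<lambda>i r. v r $ i)"
  have inj: "inj_on v I"
  proof (rule inj_onI, rule ccontr)
    fix r s assume rs: "r \<in> I" "s \<in> I" "v r = v s" "r \<noteq> s"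
    define c :: "_ \<Rightarrow> 'a" where "c q = (if q = r then 1 else 0) - (if q = s then 1 else 0)" for q
    have "(\<Sum>q\<in>I. c q * v q $ i) = 0" for i
    proof -
      have "(\<Sum>q\<in>I. c q * v q $ i)
          = (\<Sum>q\<in>I. if q = r then v q $ i else 0) - (\<Sum>q\<in>I. if q = s then v q $ i else 0)"
        unfolding sum_subtractf[symmetric] by (intro sum.cong) (auto simp: c_def)
      then show ?thesis
        using rs fin by simp
    qed
    then have "c r = 0"
      using independent_onD[OF indep, of c r] rs by blast
    then show False
      using rs by (simp add: c_def)
  qed
  moreover have "lin_indpt (v ` I)"
  proof (rule finite_lin_indpt2)
    fix a assume a: "lincomb a (v ` I) = 0\<^sub>v n"
    have "(\<Sum>s\<in>I. a (v s) * v s $ i) = 0" if "i \<in> {..<n}" for i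
    proof -
      have "(\<Sum>s\<in>I. a (v s) * v s $ i) = lincomb a (v ` I) $ i"
        using inj that by (simp add: lincomb_index[OF _ v] sum.reindex)
      then show ?thesis
        using a that by simp
    qed
    then show "\<forall>u\<in>v ` I. a u = 0"
      using independent_onD[OF indep, of "a \<circ> v"] by auto
  qed (use fin v in auto)
  ultimately show "inj_on v I \<and> lin_indpt (v ` I)" ..
qed

lemma rank_eq_card_of_basis:
  assumes "finite S" "S \<subseteq> carrier_vec n" "lin_indpt S" "span S = span (set (cols A))"
  shows "rank A = card S"
proof -
  have "maximal S (\<lambda>T. T \<subseteq> S \<and> lin_indpt T)"
    using assms(3) by (auto simp: maximal_def)
  then show ?thesis
    using dim_span[of S S] assms by (simp add: rank_def)
qed

lemma maximal_lin_indpt_spans: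
  assumes S: "S \<subseteq> carrier_vec n"
    and max: "maximal U (\<lambda>T. T \<subseteq> S \<and> lin_indpt T)"
  shows "S \<subseteq> span U"
proof
  fix s assume s: "s \<in> S"
  have U: "U \<subseteq> S" "lin_indpt U"
    using max by (auto simp: maximal_def)
  then have UC: "U \<subseteq> carrier_vec n" using S by blast
  show "s \<in> span U"
  proof (rule ccontr)
    assume ns: "s \<notin> span U"
    then have "s \<notin> U" using span_mem[of U s] UC by auto
    then have "lin_indpt (U \<union> {s})"
      using lin_dep_iff_in_span[of U s] ns U(2) UC s S by auto
    then have "U \<union> {s} = U"
      using max U(1) s unfolding maximal_def by blast
    with \<open>s \<notin> U\<close> show False by blast
  qed
qed

text \<open>
  In the forward direction the basis consists of columns of \<open>A\<close>. The column \<open>k r\<close> equal to the basis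
  vector \<open>r\<close> has the unit vector at \<open>r\<close> as its coordinates, so restricting the right factors to the
  indices \<open>k r\<close> gives an identity matrix.
\<close>

theorem rank_eq_iff_outer_product_sum:
  assumes A: "A \<in> carrier_mat n nc"
  shows "rank A = \<rho> \<longleftrightarrow>
    (\<exists>b a. (\<forall>i<n. \<forall>j<nc. A $$ (i, j) = (\<Sum>r = 1..\<rho>. b i r * a j r)) \<and>
      independent_on {..<n} {1..\<rho>} b \<and> independent_on {..<nc} {1..\<rho>} a)"
proof
  assume rank: "rank A = \<rho>"
  have colsC: "set (cols A) \<subseteq> carrier_vec n"
    using cols_dim A by blast
  obtain S where S: "maximal S (\<lambda>T. T \<subseteq> set (cols A) \<and> lin_indpt T)" "finite S"
    using maximal_exists_superset[of "set (cols A)" "\<lambda>T. T \<subseteq> set (cols A) \<and> lin_indpt T" "{}"]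
    by (auto simp: lin_dep_def)
  then have S_sub: "S \<subseteq> set (cols A)" and S_indpt: "lin_indpt S"
    by (auto simp: maximal_def)
  have "card S = \<rho>"
    using rank_card_indpt[OF A S(1)] rank by simp
  then obtain v where v: "bij_betw v {1..\<rho>} S"
    using ex_bij_betw_nat_finite_1[OF S(2)] by blast
  then have vS: "v ` {1..\<rho>} = S" and v_inj: "inj_on v {1..\<rho>}"
    by (auto simp: bij_betw_def)
  have v_indep: "independent_on {..<n} {1..\<rho>} (\<lambda>i r. v r $ i)"
    using inj_on_and_lin_indpt_iff[of "{1..\<rho>}" v] vS v_inj S_indpt S_sub colsC by auto
  have "\<exists>c. \<forall>i<n. A $$ (i, j) = (\<Sum>r = 1..\<rho>. v r $ i * c r)" if j: "j < nc" for j
  proof -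
    have "col A j \<in> span S"
      using maximal_lin_indpt_spans[OF colsC S(1)] j A by (auto simp: cols_def)
    then obtain c where c: "lincomb c S = col A j"
      using finite_in_span[of S "col A j"] S(2) S_sub colsC by auto
    have "A $$ (i, j) = (\<Sum>r = 1..\<rho>. v r $ i * c (v r))" if i: "i < n" for i
    proof -
      have "A $$ (i, j) = lincomb c S $ i"
        using c i j A by simp
      also have "\<dots> = (\<Sum>r = 1..\<rho>. v r $ i * c (v r))"
        using S_sub colsC v_inj
        by (subst lincomb_index[OF i]) (auto simp: vS[symmetric] sum.reindex mult.commute)
      finally show ?thesis .
    qed
    then show ?thesis by (intro exI[of _ "c \<circ> v"]) simp
  qed
  then obtain a where a: "A $$ (i, j) = (\<Sum>r = 1..\<rho>. v r $ i * a j r)" if "i < n" "j < nc" for i j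
    by metis
  have "\<forall>r\<in>{1..\<rho>}. \<exists>j<nc. v r = col A j"
  proof
    fix r assume "r \<in> {1..\<rho>}"
    then have "v r \<in> set (cols A)" using vS S_sub by blast
    then show "\<exists>j<nc. v r = col A j" using A by (auto simp: cols_def)
  qed
  then obtain k where k: "k r < nc" "v r = col A (k r)" if "r \<in> {1..\<rho>}" for r
    by metis
  have ak: "a (k r) s = (if s = r then 1 else 0)" if r: "r \<in> {1..\<rho>}" and s: "s \<in> {1..\<rho>}" for r s
  proof -
    let ?c = "\<lambda>s. a (k r) s - (if s = r then 1 else 0)"
    have "(\<Sum>s = 1..\<rho>. ?c s * v s $ i) = 0" if "i \<in> {..<n}" for i
    proof -
      have "(\<Sum>s = 1..\<rho>. ?c s * v s $ i)
          = (\<Sum>s = 1..\<rho>. v s $ i * a (k r) s) - (\<Sum>s = 1..\<rho>. if s = r then v s $ i else 0)"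
        unfolding sum_subtractf[symmetric] by (intro sum.cong) (auto simp: algebra_simps)
      also have "\<dots> = A $$ (i, k r) - v r $ i"
        using a[of i "k r"] k(1)[OF r] that r by simp
      also have "\<dots> = 0"
        using k[OF r] that A by simp
      finally show ?thesis .
    qed
    then have "?c s = 0"
      using independent_onD[OF v_indep, of ?c s] s by blast
    then show ?thesis by simp
  qed
  have "independent_on {..<nc} {1..\<rho>} a"
    unfolding independent_on_def
  proof (intro allI impI ballI)
    fix c r
    assume c: "\<forall>j\<in>{..<nc}. (\<Sum>s = 1..\<rho>. c s * a j s) = 0" and r: "r \<in> {1..\<rho>}"
    have "(\<Sum>s = 1..\<rho>. c s * a (k r) s) = (\<Sum>s = 1..\<rho>. if s = r then c s else 0)"
      using ak r by (intro sum.cong) auto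
    also have "\<dots> = c r" using r by simp
    finally show "c r = 0" using c k(1)[OF r] by simp
  qed
  with a v_indep show "\<exists>b a. (\<forall>i<n. \<forall>j<nc. A $$ (i, j) = (\<Sum>r = 1..\<rho>. b i r * a j r)) \<and>
      independent_on {..<n} {1..\<rho>} b \<and> independent_on {..<nc} {1..\<rho>} a"
    by (intro exI[of _ "\<lambda>i r. v r $ i"] exI[of _ a]) simp
next
  assume "\<exists>b a. (\<forall>i<n. \<forall>j<nc. A $$ (i, j) = (\<Sum>r = 1..\<rho>. b i r * a j r)) \<and>
      independent_on {..<n} {1..\<rho>} b \<and> independent_on {..<nc} {1..\<rho>} a"
  then obtain b a
    where A_eq: "\<forall>i<n. \<forall>j<nc. A $$ (i, j) = (\<Sum>r = 1..\<rho>. b i r * a j r)"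
    and b: "independent_on {..<n} {1..\<rho>} b" and a: "independent_on {..<nc} {1..\<rho>} a"
    by blast
  have colsC: "set (cols A) \<subseteq> carrier_vec n"
    using cols_dim A by blast
  define v where "v r = vec n (\<lambda>i. b i r)" for r
  have v_i: "v r $ i = b i r" if "i < n" for i r
    using that by (simp add: v_def)
  define S where "S = v ` {1..\<rho>}"
  have SC: "S \<subseteq> carrier_vec n" "finite S" by (auto simp: S_def v_def)
  have "independent_on {..<n} {1..\<rho>} (\<lambda>i r. v r $ i)"
    using b by (subst independent_on_cong[of _ _ _ b]) (auto simp: v_i)
  then have v_inj: "inj_on v {1..\<rho>}" and S_indpt: "lin_indpt S"
    using inj_on_and_lin_indpt_iff[of "{1..\<rho>}" v] SC by (auto simp: S_def)
  have "set (cols A) \<subseteq> span S"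
  proof
    fix u assume "u \<in> set (cols A)"
    then obtain j where j: "j < nc" "u = col A j" using A by (auto simp: cols_def)
    have "u = lincomb (\<lambda>x. a j (inv_into {1..\<rho>} v x)) S"
    proof (rule eq_vecI)
      show "dim_vec u = dim_vec (lincomb (\<lambda>x. a j (inv_into {1..\<rho>} v x)) S)"
        using j A by (simp add: lincomb_dim[OF SC(2,1)])
      fix i assume "i < dim_vec (lincomb (\<lambda>x. a j (inv_into {1..\<rho>} v x)) S)"
      then have i: "i < n" by (simp add: lincomb_dim[OF SC(2,1)])
      have "lincomb (\<lambda>x. a j (inv_into {1..\<rho>} v x)) S $ i = (\<Sum>r = 1..\<rho>. b i r * a j r)"
        using v_inj v_i[OF i]
        by (subst lincomb_index[OF i SC(1)]) (simp add: S_def sum.reindex mult.commute)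
      then show "u $ i = lincomb (\<lambda>x. a j (inv_into {1..\<rho>} v x)) S $ i"
        using A_eq i j A by simp
    qed
    then show "u \<in> span S" by (rule in_spanI) (auto simp: S_def)
  qed
  moreover have "S \<subseteq> span (set (cols A))"
  proof
    fix u assume "u \<in> S"
    then obtain s where s: "s \<in> {1..\<rho>}" "u = v s" by (auto simp: S_def)
    obtain d where d: "\<forall>r\<in>{1..\<rho>}. \<forall>s\<in>{1..\<rho>}.
        (\<Sum>j<nc. d r j * a j s) = (if r = s then 1 else 0)"
      using independent_on_imp_dual_family[OF finite_atLeastAtMost finite_lessThan a] by blast
    \<comment> \<open>The dual vector \<open>d s\<close> pairs to zero with every right factor except factor \<open>s\<close>.\<close>
    have "u = A *\<^sub>v vec nc (d s)"
    proof (rule eq_vecI)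
      show "dim_vec u = dim_vec (A *\<^sub>v vec nc (d s))"
        using s A by (simp add: v_def)
      fix i assume "i < dim_vec (A *\<^sub>v vec nc (d s))"
      then have i: "i < n" using A by simp
      have "(A *\<^sub>v vec nc (d s)) $ i = (\<Sum>j<nc. A $$ (i, j) * d s j)"
        using A i by (simp add: scalar_prod_def lessThan_atLeast0)
      also have "\<dots> = (\<Sum>j<nc. \<Sum>r = 1..\<rho>. b i r * (d s j * a j r))"
        using i by (intro sum.cong) (auto simp: A_eq sum_distrib_left mult_ac)
      also have "\<dots> = (\<Sum>r = 1..\<rho>. b i r * (\<Sum>j<nc. d s j * a j r))"
        by (subst sum.swap) (simp add: sum_distrib_left)
      also have "\<dots> = (\<Sum>r = 1..\<rho>. if r = s then b i r else 0)"
        using d s(1) by (intro sum.cong) auto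
      finally show "u $ i = (A *\<^sub>v vec nc (d s)) $ i"
        using s i by (simp add: v_def)
    qed
    then show "u \<in> span (set (cols A))"
      using col_space_eq[OF A] A by (auto simp: col_space_def)
  qed
  ultimately have "span S = span (set (cols A))"
    using span_subsetI SC colsC by (metis subset_antisym)
  then have "rank A = card S"
    using rank_eq_card_of_basis SC S_indpt by (auto simp: S_def)
  then show "rank A = \<rho>"
    using card_image[OF v_inj] by (simp add: S_def)
qed

end

lemma lin_indpt_family_vec_iff:
  assumes "finite I"
  shows "lin_indpt_family n I (\<lambda>r. vec n (\<lambda>i. b i r)) \<longleftrightarrow> independent_on {..<n} I b"
proof -
  interpret vec_space "TYPE(complex)" n .
  let ?v = "\<lambda>r. vec n (\<lambda>i. b i r)"
  have C: "?v ` I \<subseteq> carrier_vec n" by auto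
  show ?thesis
    using inj_on_and_lin_indpt_iff[OF assms C] C
      independent_on_cong[of "{..<n}" I "\<lambda>i r. ?v r $ i" b]
    by (auto simp: lin_indpt_family_def)
qed

section \<open>Coefficients of bivariate polynomials\<close>

lemma Lam_in_w_mult_in_z:
  "Lam (in_w g * in_z h) j k = Polynomial.coeff h j * Polynomial.coeff g k"
  by (simp add: Lam_def in_w_def in_z_def coeff_map_poly mult.commute)

lemma Lam_sum: "Lam (\<Sum>r\<in>I. f r) j k = (\<Sum>r\<in>I. Lam (f r) j k)"
  by (simp add: Lam_def coeff_sum)

lemma eq_iff_Lam_eq: "P = Q \<longleftrightarrow> (\<forall>j k. Lam P j k = Lam Q j k)"
  by (auto simp: Lam_def poly_eq_iff)

lemma coeff_sum_monom_le:
  "Polynomial.coeff (\<Sum>n = 0..d. Polynomial.monom (c n) n) k = (if k \<le> d then c k else 0)"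
  by (simp add: coeff_sum)

lemma Lam_eq_0_if_bidegree_less:
  assumes "deg_z P < j \<or> deg_w P < k"
  shows "Lam P j k = 0"
proof (cases "deg_z P < j")
  case True
  then show ?thesis by (simp add: Lam_def deg_z_def coeff_eq_0)
next
  case False
  then have "Polynomial.degree (Polynomial.coeff P j) \<le> deg_w P"
    unfolding deg_w_def deg_z_def by (intro Max_ge) auto
  then show ?thesis
    using False assms by (auto simp: Lam_def intro: coeff_eq_0)
qed

lemma ex_Lam_deg_z_nonzero:
  assumes "0 < deg_z P"
  obtains k where "Lam P (deg_z P) k \<noteq> 0"
  using assms by (metis Lam_def deg_z_def degree_0 leading_coeff_0_iff less_numeral_extra(3))

lemma ex_Lam_deg_w_nonzero:
  assumes "0 < deg_w P"
  obtains j where "Lam P j (deg_w P) \<noteq> 0"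
proof -
  have "deg_w P \<in> (\<lambda>j. Polynomial.degree (Polynomial.coeff P j)) ` {..Polynomial.degree P}"
    unfolding deg_w_def by (rule Max_in) auto
  then obtain j where j: "deg_w P = Polynomial.degree (Polynomial.coeff P j)" by blast
  then have "Lam P j (deg_w P) \<noteq> 0"
    using assms by (auto simp: Lam_def)
  then show thesis by (rule that)
qed

lemma eq_sum_in_w_mult_in_z_iff:
  assumes "deg_z P \<le> dw" "deg_w P \<le> dz"
    and g: "\<And>r. r \<in> I \<Longrightarrow> g r = (\<Sum>n = 0..dz. Polynomial.monom (\<alpha> n r) n)"
    and h: "\<And>r. r \<in> I \<Longrightarrow> h r = (\<Sum>m = 0..dw. Polynomial.monom (\<beta> m r) m)"
  shows "P = (\<Sum>r\<in>I. in_w (g r) * in_z (h r)) \<longleftrightarrow>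
    (\<forall>j\<le>dw. \<forall>k\<le>dz. Lam P j k = (\<Sum>r\<in>I. \<beta> j r * \<alpha> k r))"
proof -
  have "Lam (\<Sum>r\<in>I. in_w (g r) * in_z (h r)) j k
      = (if j \<le> dw \<and> k \<le> dz then \<Sum>r\<in>I. \<beta> j r * \<alpha> k r else 0)" for j k
    by (auto simp: Lam_sum Lam_in_w_mult_in_z g h coeff_sum_monom_le
        intro!: sum.cong sum.neutral)
  moreover have "Lam P j k = 0" if "\<not> (j \<le> dw \<and> k \<le> dz)" for j k
    using that assms(1,2) by (intro Lam_eq_0_if_bidegree_less) auto
  ultimately show ?thesis
    by (auto simp: eq_iff_Lam_eq)
qed

section \<open>Rank of the associated matrix\<close>

text \<open>
  The rows and columns of the associated matrix run through the exponents downwards, hence the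
  reversal of both factors.
\<close>

lemma rank_assoc_mat_eq_iff:
  "vec_space.rank (dw + 1) (assoc_mat dw dz P) = \<rho> \<longleftrightarrow>
    (\<exists>\<alpha> \<beta>. (\<forall>j\<le>dw. \<forall>k\<le>dz. Lam P j k = (\<Sum>r = 1..\<rho>. \<beta> j r * \<alpha> k r)) \<and>
      independent_on {..<dw + 1} {1..\<rho>} \<beta> \<and> independent_on {..<dz + 1} {1..\<rho>} \<alpha>)"
  (is "?R \<longleftrightarrow> (\<exists>\<alpha> \<beta>. ?F \<alpha> \<beta>)")
proof -
  let ?G = "\<lambda>b a. (\<forall>i<dw + 1. \<forall>j<dz + 1.
      assoc_mat dw dz P $$ (i, j) = (\<Sum>r = 1..\<rho>. b i r * a j r)) \<and>
    independent_on {..<dw + 1} {1..\<rho>} b \<and> independent_on {..<dz + 1} {1..\<rho>} a"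
  have "assoc_mat dw dz P \<in> carrier_mat (dw + 1) (dz + 1)"
    by (simp add: assoc_mat_def)
  then have "?R \<longleftrightarrow> (\<exists>b a. ?G b a)"
    by (rule vec_space.rank_eq_iff_outer_product_sum)
  also have "\<dots> \<longleftrightarrow> (\<exists>\<alpha> \<beta>. ?F \<alpha> \<beta>)"
  proof
    assume "\<exists>b a. ?G b a"
    then obtain b a where G: "?G b a" by (elim exE)
    have "Lam P j k = (\<Sum>r = 1..\<rho>. b (dw - j) r * a (dz - k) r)" if "j \<le> dw" "k \<le> dz" for j k
    proof -
      have "assoc_mat dw dz P $$ (dw - j, dz - k) = Lam P j k"
        using that by (simp add: assoc_mat_def)
      then show ?thesis using G by simp
    qed
    then have "?F (\<lambda>k. a (dz - k)) (\<lambda>j. b (dw - j))"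
      using G independent_on_rev[of dw "{1..\<rho>}" b] independent_on_rev[of dz "{1..\<rho>}" a]
      by simp
    then show "\<exists>\<alpha> \<beta>. ?F \<alpha> \<beta>" by (intro exI)
  next
    assume "\<exists>\<alpha> \<beta>. ?F \<alpha> \<beta>"
    then obtain \<alpha> \<beta> where F: "?F \<alpha> \<beta>" by (elim exE)
    then have "?G (\<lambda>i. \<beta> (dw - i)) (\<lambda>j. \<alpha> (dz - j))"
      using independent_on_rev[of dw "{1..\<rho>}" \<beta>] independent_on_rev[of dz "{1..\<rho>}" \<alpha>]
      by (simp add: assoc_mat_def)
    then show "\<exists>b a. ?G b a" by (intro exI)
  qed
  finally show ?thesis .
qed

theorem lemma6p1:
  fixes dw dz \<rho> :: nat and P :: "complex poly poly"
  assumes "poly_correspondence dw dz P"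
    and "1 < dw \<or> 1 < dz"
    and "restrictive dw dz P"
    and "0 < \<rho>"
  shows "vec_space.rank (dw + 1) (assoc_mat dw dz P) = \<rho> \<longleftrightarrow>
    (\<exists>(g :: nat \<Rightarrow> complex poly) (h :: nat \<Rightarrow> complex poly)
      (\<alpha> :: nat \<Rightarrow> nat \<Rightarrow> complex) (\<beta> :: nat \<Rightarrow> nat \<Rightarrow> complex).
      (P = (\<Sum>r = 1..\<rho>. in_w (g r) * in_z (h r)) \<and>
       (\<forall>r\<in>{1..\<rho>}. g r = (\<Sum>n = 0..dz. Polynomial.monom (\<alpha> n r) n)) \<and>
       (\<forall>r\<in>{1..\<rho>}. h r = (\<Sum>m = 0..dw. Polynomial.monom (\<beta> m r) m)) \<and>
       (\<exists>r\<in>{1..\<rho>}. \<alpha> dz r \<noteq> 0) \<and>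
       (\<exists>r\<in>{1..\<rho>}. \<beta> dw r \<noteq> 0)) \<and>
      lin_indpt_family (dw + 1) {1..\<rho>} (\<lambda>r. vec (dw + 1) (\<lambda>m. \<beta> m r)) \<and>
      lin_indpt_family (dz + 1) {1..\<rho>} (\<lambda>r. vec (dz + 1) (\<lambda>n. \<alpha> n r)))"
    (is "?R \<longleftrightarrow> ?E")
proof
  have deg: "deg_z P = dw" "deg_w P = dz" "0 < dw" "0 < dz"
    using assms(1) by (auto simp: poly_correspondence_def)
  assume ?R
  then obtain \<alpha> \<beta>
    where Lam: "\<forall>j\<le>dw. \<forall>k\<le>dz. Lam P j k = (\<Sum>r = 1..\<rho>. \<beta> j r * \<alpha> k r)"
    and \<beta>: "independent_on {..<dw + 1} {1..\<rho>} \<beta>"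
    and \<alpha>: "independent_on {..<dz + 1} {1..\<rho>} \<alpha>"
    unfolding rank_assoc_mat_eq_iff by blast
  define g where "g r = (\<Sum>n = 0..dz. Polynomial.monom (\<alpha> n r) n)" for r
  define h where "h r = (\<Sum>m = 0..dw. Polynomial.monom (\<beta> m r) m)" for r
  have "P = (\<Sum>r = 1..\<rho>. in_w (g r) * in_z (h r))"
    using eq_sum_in_w_mult_in_z_iff[of P dw dz "{1..\<rho>}" g \<alpha> h \<beta>] deg Lam
    by (simp add: g_def h_def)
  moreover have "\<exists>r\<in>{1..\<rho>}. \<alpha> dz r \<noteq> 0"
  proof -
    obtain j where j: "Lam P j dz \<noteq> 0"
      using ex_Lam_deg_w_nonzero[of P] deg by auto
    then have "j \<le> dw"
      using Lam_eq_0_if_bidegree_less[of P j dz] deg by force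
    then show ?thesis
      using j Lam by (metis (no_types, lifting) mult_zero_right order_refl sum.neutral)
  qed
  moreover have "\<exists>r\<in>{1..\<rho>}. \<beta> dw r \<noteq> 0"
  proof -
    obtain k where k: "Lam P dw k \<noteq> 0"
      using ex_Lam_deg_z_nonzero[of P] deg by auto
    then have "k \<le> dz"
      using Lam_eq_0_if_bidegree_less[of P dw k] deg by force
    then show ?thesis
      using k Lam by (metis (no_types, lifting) mult_zero_left order_refl sum.neutral)
  qed
  moreover have "lin_indpt_family (dw + 1) {1..\<rho>} (\<lambda>r. vec (dw + 1) (\<lambda>m. \<beta> m r))"
    "lin_indpt_family (dz + 1) {1..\<rho>} (\<lambda>r. vec (dz + 1) (\<lambda>n. \<alpha> n r))"
    using \<alpha> \<beta> by (simp_all only: lin_indpt_family_vec_iff finite_atLeastAtMost)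
  ultimately show ?E
    by (intro exI[of _ g] exI[of _ h] exI[of _ \<alpha>] exI[of _ \<beta>]) (simp add: g_def h_def)
next
  have deg: "deg_z P = dw" "deg_w P = dz"
    using assms(1) by (auto simp: poly_correspondence_def)
  assume ?E
  then obtain g h \<alpha> \<beta> where P: "P = (\<Sum>r = 1..\<rho>. in_w (g r) * in_z (h r))"
    and g: "\<forall>r\<in>{1..\<rho>}. g r = (\<Sum>n = 0..dz. Polynomial.monom (\<alpha> n r) n)"
    and h: "\<forall>r\<in>{1..\<rho>}. h r = (\<Sum>m = 0..dw. Polynomial.monom (\<beta> m r) m)"
    and \<beta>: "lin_indpt_family (dw + 1) {1..\<rho>} (\<lambda>r. vec (dw + 1) (\<lambda>m. \<beta> m r))"
    and \<alpha>: "lin_indpt_family (dz + 1) {1..\<rho>} (\<lambda>r. vec (dz + 1) (\<lambda>n. \<alpha> n r))"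
    by blast
  have "\<forall>j\<le>dw. \<forall>k\<le>dz. Lam P j k = (\<Sum>r = 1..\<rho>. \<beta> j r * \<alpha> k r)"
    using eq_sum_in_w_mult_in_z_iff[of P dw dz "{1..\<rho>}" g \<alpha> h \<beta>] deg P g h by simp
  moreover have "independent_on {..<dw + 1} {1..\<rho>} \<beta>" "independent_on {..<dz + 1} {1..\<rho>} \<alpha>"
    using \<alpha> \<beta> by (simp_all only: lin_indpt_family_vec_iff finite_atLeastAtMost)
  ultimately show ?R
    unfolding rank_assoc_mat_eq_iff by blast
qed

end
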